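(* Let $A\subseteq\mathbb{N}$. Then $A$ is a zero-solution set if and only if $A$ is an AP-set.
   Context: $\mathbb{N}=\{1,2,3,\ldots\}$. For integers $k,d\ge 1$ and $a\ge 0$, the arithmetic progression of length $k$, base $a$ and step $d$ is the set $\mathrm{AP}(k,a,d)=\{a+\lambda d \mid \lambda\in\mathbb{Z},\ 0\le\lambda<k\}$. A set $A\subseteq\mathbb{N}$ is an AP-set if for every integer $k\ge 1$ there exists a pair $(a,d)\in\mathbb{N}^2$ such that $\mathrm{AP}(k,a,d)\subseteq A$. For an integer matrix $M$ with $n$ columns, $N(M)=\{x\in\mathbb{R}^n : Mx=0\}$ denotes its nullspace. $M$ is called null-diagonal if $\dim N(M)\ge 2$ and $(1,1,\ldots,1)\in N(M)$. A set $A\subseteq\mathbb{N}$ is a zero-solution set if for every null-diagonal integer matrix $M$ (of any size, with $n$ columns, say), the nullspace $N(M)$ contains infinitely many vectors $x=(x_1,\ldots,x_n)$ with $x_1,\ldots,x_n\in A$ and $x_i\ne x_j$ for some $i,j$. *)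

theory Defs
  imports Complex_Main "Jordan_Normal_Form.Matrix_Kernel"
begin

definition AP :: "nat \<Rightarrow> nat \<Rightarrow> nat \<Rightarrow> nat set" where
  "AP k a d = {a + l * d | l. l < k}"

definition AP_set :: "nat set \<Rightarrow> bool" where
  "AP_set A \<longleftrightarrow> (\<forall>k\<ge>1. \<exists>a\<ge>1. \<exists>d\<ge>1. AP k a d \<subseteq> A)"

(* mat_kernel alone, applied to an integer matrix, would only yield the integer solutions. *)
definition nullspace :: "int mat \<Rightarrow> real vec set" where
  "nullspace M = mat_kernel (map_mat real_of_int M)"

definition null_diagonal :: "int mat \<Rightarrow> bool" where
  "null_diagonal M \<longleftrightarrow>
     kernel_dim (map_mat real_of_int M) \<ge> 2 \<and> vec (dim_col M) (\<lambda>_. 1) \<in> nullspace M"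

definition zero_solution_set :: "nat set \<Rightarrow> bool" where
  "zero_solution_set A \<longleftrightarrow>
     (\<forall>M. null_diagonal M \<longrightarrow>
        infinite {x \<in> nullspace M.
          (\<forall>i < dim_col M. x $ i \<in> real ` A) \<and>
          (\<exists>i < dim_col M. \<exists>j < dim_col M. x $ i \<noteq> x $ j)})"

end

theory Submission
  imports "HOL-Analysis.Kronecker_Approximation_Theorem" Defs
begin

unbundle no vec_syntax

(* If A contains long progressions and M is null-diagonal, simultaneous Diophantine approximation
   turns a non-constant real vector of N(M) into a non-constant integer one, which the all-ones
   vector shifts to a natural one v. Then a * 1 + d * v lies in N(M), with entries in the progression
   AP(k,a,d) as soon as k exceeds all entries of v; the shifts a + j * d supply as many such
   vectors as desired. Conversely, the kernel of the second difference operator consists of the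
   arithmetic progressions of a given length. *)

section \<open>Nullspaces, kernel dimension and nonconstant kernel vectors\<close>

lemma nullspace_iff:
  "v \<in> nullspace M \<longleftrightarrow> v \<in> carrier_vec (dim_col M) \<and>
     (\<forall>r < dim_row M. (\<Sum>i<dim_col M. real_of_int (M $$ (r, i)) * v $ i) = 0)"
  by (auto simp: nullspace_def mat_kernel_def vec_eq_iff scalar_prod_def atLeast0LessThan)

lemma vec_in_nullspace_iff:
  "vec (dim_col M) f \<in> nullspace M \<longleftrightarrow>
     (\<forall>r < dim_row M. (\<Sum>i<dim_col M. real_of_int (M $$ (r, i)) * f i) = 0)"
  by (simp add: nullspace_iff)

text \<open>The two hypotheses make \<open>{u}\<close> a generating set of the kernel, and one
  generator bounds the dimension by 1.\<close>

lemma kernel_dim_le_1: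
  fixes B :: "'a :: field mat"
  assumes u: "u \<in> mat_kernel B"
    and multiples: "\<And>v. v \<in> mat_kernel B \<Longrightarrow> \<exists>c. v = c \<cdot>\<^sub>v u"
  shows "kernel_dim B \<le> 1"
proof -
  interpret K: kernel "dim_row B" "dim_col B" B
    by unfold_locales auto
  have sub: "K.span {u} \<subseteq> mat_kernel B"
    using K.Ker.span_is_subset2[of "{u}"] u by simp
  have "mat_kernel B \<subseteq> K.span {u}"
  proof
    fix v assume "v \<in> mat_kernel B"
    then obtain c where c: "v = c \<cdot>\<^sub>v u"
      using multiples by blast
    have "u \<in> K.span {u}"
      using K.Ker.span_mem[of "{u}" u] u by simp
    then show "v \<in> K.span {u}"
      using submodule.smult_closed[OF K.Ker.span_is_submodule, of "{u}" c u] u c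
      by (simp add: class_ring_simps)
  qed
  then have "K.gen_set {u}"
    using sub by auto
  then show ?thesis
    using K.Ker.dim_le1I[of u] u by simp
qed

text \<open>The kernel dimension counts the columns without a pivot in the echelon form. Pivots
  correspond to nonzero rows, so there are at most \<open>dim_row B\<close> of them.\<close>

lemma kernel_dim_ge_diff: "dim_col B - dim_row B \<le> kernel_dim B" for B :: "'a :: field mat"
proof -
  let ?C = "gauss_jordan_single B"
  have "B \<in> carrier_mat (dim_row B) (dim_col B)"
    by simp
  from gauss_jordan_single[OF this refl]
  have C: "?C \<in> carrier_mat (dim_row B) (dim_col B)" and "row_echelon_form ?C"
    by auto
  then have "length (pivot_positions ?C) =
      card {i. i < dim_row B \<and> row ?C i \<noteq> 0\<^sub>v (dim_col B)}"
    using find_base_vectors(5) by blast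
  also have "\<dots> \<le> card {..<dim_row B}"
    by (rule card_mono) auto
  finally show ?thesis
    unfolding kernel_dim_code by simp
qed

text \<open>If all kernel vectors were constant, the all-ones vector would generate the kernel, and
  its dimension could not reach 2.\<close>

lemma null_diagonal_nonconstant:
  assumes "null_diagonal M"
  obtains y i j where "vec (dim_col M) y \<in> nullspace M"
    "i < dim_col M" "j < dim_col M" "y i \<noteq> y j"
proof (rule ccontr)
  note witness = that
  assume "\<not> thesis"
  then have const: "y i = y j"
    if "vec (dim_col M) y \<in> nullspace M" "i < dim_col M" "j < dim_col M" for y i j
    using that witness by blast
  let ?B = "map_mat real_of_int M"
  let ?u = "vec (dim_col M) (\<lambda>_. 1::real)"
  have "kernel_dim ?B \<le> 1"
  proof (rule kernel_dim_le_1)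
    show "?u \<in> mat_kernel ?B"
      using assms by (simp add: null_diagonal_def nullspace_def)
    fix v assume "v \<in> mat_kernel ?B"
    then have v: "v \<in> nullspace M"
      by (simp add: nullspace_def)
    then have dim: "dim_vec v = dim_col M"
      by (simp add: nullspace_iff carrier_vecD)
    then have "vec (dim_col M) (\<lambda>i. v $ i) = v"
      by (intro eq_vecI) simp_all
    with v have eq: "v $ i = v $ 0" if "i < dim_col M" for i
      using that by (intro const[of "\<lambda>i. v $ i"]) simp_all
    \<comment> \<open>If there are no columns, \<open>v $ 0\<close> is unspecified, but then both
      sides are the empty vector.\<close>
    have "v = v $ 0 \<cdot>\<^sub>v ?u"
    proof (rule eq_vecI)
      fix i assume "i < dim_vec (v $ 0 \<cdot>\<^sub>v ?u)"
      then show "v $ i = (v $ 0 \<cdot>\<^sub>v ?u) $ i"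
        using eq[of i] by simp
    qed (simp add: dim)
    then show "\<exists>c. v = c \<cdot>\<^sub>v ?u" ..
  qed
  with assms show False
    by (simp add: null_diagonal_def)
qed

section \<open>From real to natural solutions; AP-sets are zero-solution sets\<close>

lemma integer_solution_of_real_solution:
  fixes c :: "nat \<Rightarrow> nat \<Rightarrow> int" and y :: "nat \<Rightarrow> real"
  assumes sol: "\<And>r. r < m \<Longrightarrow> (\<Sum>i<n. of_int (c r i) * y i) = 0"
    and ab: "a < n" "b < n" "y a \<noteq> y b"
  obtains p :: "nat \<Rightarrow> int"
  where "\<And>r. r < m \<Longrightarrow> (\<Sum>i<n. c r i * p i) = 0" "p a \<noteq> p b"
proof -
  define C where "C = (\<Sum>r<m. \<Sum>i<n. \<bar>real_of_int (c r i)\<bar>)"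
  \<comment> \<open>The vector \<open>p\<close> will be a rounding of \<open>q * y\<close> with
    errors below \<open>1 / N\<close>. The bound \<open>C < N\<close> keeps the total error of each
    row below 1, and \<open>2 / \<bar>y a - y b\<bar> < N\<close> keeps the entries at
    \<open>a\<close> and \<open>b\<close> apart.\<close>
  obtain N :: nat where N: "max C (2 / \<bar>y a - y b\<bar>) < N"
    using reals_Archimedean2 by blast
  have "C \<ge> 0"
    unfolding C_def by (intro sum_nonneg) auto
  with N have "N > 0" "C < N"
    by auto
  obtain q p where "0 < q"
    and approx: "\<And>i. i < n \<Longrightarrow> \<bar>of_int q * y i - of_int (p i)\<bar> < 1 / N"
    using Dirichlet_approx_simult[OF \<open>N > 0\<close>, of n y] by metis
  show thesis
  proof
    fix r assume "r < m"
    \<comment> \<open>Since \<open>y\<close> solves the row exactly, only rounding errors remain.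
      The row value at \<open>p\<close> is thus an integer of absolute value below 1, hence
      0.\<close>
    have "real_of_int (\<Sum>i<n. c r i * p i) =
        q * (\<Sum>i<n. c r i * y i) - (\<Sum>i<n. c r i * (q * y i - p i))"
      by (simp add: sum_distrib_left sum_subtractf algebra_simps)
    then have "\<bar>real_of_int (\<Sum>i<n. c r i * p i)\<bar> = \<bar>\<Sum>i<n. c r i * (q * y i - p i)\<bar>"
      using sol[OF \<open>r < m\<close>] by simp
    also have "\<dots> \<le> (\<Sum>i<n. \<bar>real_of_int (c r i)\<bar> * (1 / N))"
    proof (intro order_trans[OF sum_abs] sum_mono)
      fix i assume "i \<in> {..<n}"
      then show "\<bar>c r i * (q * y i - p i)\<bar> \<le> \<bar>real_of_int (c r i)\<bar> * (1 / N)"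
        unfolding abs_mult using approx[of i] by (intro mult_left_mono) auto
    qed
    also have "\<dots> = (\<Sum>i<n. \<bar>real_of_int (c r i)\<bar>) / N"
      by (simp add: sum_divide_distrib)
    also have "(\<Sum>i<n. \<bar>real_of_int (c r i)\<bar>) \<le> C"
      unfolding C_def using \<open>r < m\<close>
      by (intro member_le_sum[where f = "\<lambda>r. \<Sum>i<n. \<bar>real_of_int (c r i)\<bar>"]) (auto intro: sum_nonneg)
    then have "(\<Sum>i<n. \<bar>real_of_int (c r i)\<bar>) / N < 1"
      using \<open>C < N\<close> \<open>N > 0\<close> by simp
    finally show "(\<Sum>i<n. c r i * p i) = 0"
      by linarith
  next
    \<comment> \<open>Scaling by the positive integer \<open>q\<close> does not shrink the gap, and
      the two roundings together close less than \<open>2 / N\<close> of it.\<close>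
    have "2 / N < \<bar>y a - y b\<bar>"
      using N \<open>N > 0\<close> ab(3) by (simp add: field_simps)
    also have "\<dots> \<le> \<bar>of_int q * (y a - y b)\<bar>"
      using \<open>0 < q\<close> by (simp add: abs_mult mult_le_cancel_right1)
    finally show "p a \<noteq> p b"
      using approx[OF ab(1)] approx[OF ab(2)] by (auto simp: right_diff_distrib)
  qed
qed

text \<open>Adding a multiple of the all-ones vector stays in the nullspace and preserves
  differences of entries, so an integer solution can be made nonnegative.\<close>

lemma null_diagonal_nat_solution:
  assumes M: "null_diagonal M"
  obtains v :: "nat \<Rightarrow> nat" and i j
  where "vec (dim_col M) (\<lambda>i. real (v i)) \<in> nullspace M"
    "i < dim_col M" "j < dim_col M" "v i \<noteq> v j"
proof -
  let ?n = "dim_col M"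
  obtain y a b where y: "vec ?n y \<in> nullspace M" and ab: "a < ?n" "b < ?n" "y a \<noteq> y b"
    using null_diagonal_nonconstant[OF M] .
  obtain p where p: "\<And>r. r < dim_row M \<Longrightarrow> (\<Sum>i<?n. M $$ (r, i) * p i) = 0" and "p a \<noteq> p b"
    using integer_solution_of_real_solution
      [of "dim_row M" "\<lambda>r i. M $$ (r, i)" y ?n, OF _ ab] y
    unfolding vec_in_nullspace_iff by metis
  \<comment> \<open>This shift dominates every \<open>\<bar>p i\<bar>\<close>, so \<open>nat\<close>
    truncates nothing below.\<close>
  define s where "s = (\<Sum>i<?n. \<bar>p i\<bar>)"
  have s: "0 \<le> p i + s" if "i < ?n" for i
    using member_le_sum[of i "{..<?n}" "\<lambda>i. \<bar>p i\<bar>"] that by (simp add: s_def)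
  show thesis
  proof
    have "(\<Sum>i<?n. real_of_int (M $$ (r, i)) * real (nat (p i + s))) = 0" if r: "r < dim_row M" for r
    proof -
      have "(\<Sum>i<?n. real_of_int (M $$ (r, i))) = 0"
        using M r by (simp add: null_diagonal_def vec_in_nullspace_iff)
      then have ones: "(\<Sum>i<?n. M $$ (r, i)) = 0"
        by (metis of_int_eq_0_iff of_int_sum)
      have "(\<Sum>i<?n. real_of_int (M $$ (r, i)) * real (nat (p i + s))) =
          of_int (\<Sum>i<?n. M $$ (r, i) * (p i + s))"
        using s by simp
      also have "(\<Sum>i<?n. M $$ (r, i) * (p i + s)) = 0"
        using p[OF r] ones by (simp add: distrib_left sum.distrib flip: sum_distrib_right)
      finally show ?thesis by simp
    qed
    then show "vec ?n (\<lambda>i. real (nat (p i + s))) \<in> nullspace M"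
      by (simp add: vec_in_nullspace_iff)
    show "nat (p a + s) \<noteq> nat (p b + s)"
      using \<open>p a \<noteq> p b\<close> s[OF ab(1)] s[OF ab(2)] by linarith
  qed (use ab in auto)
qed

text \<open>Finiteness is refuted by counting: a sufficiently long progression in \<open>A\<close>
  yields \<open>card ?S + 1\<close> distinct members of \<open>?S\<close>.\<close>

lemma AP_set_imp_zero_solution_set:
  assumes A: "AP_set A"
  shows "zero_solution_set A"
  unfolding zero_solution_set_def
proof (intro allI impI notI)
  fix M assume M: "null_diagonal M"
  let ?n = "dim_col M"
  let ?S = "{x \<in> nullspace M. (\<forall>i < ?n. x $ i \<in> real ` A) \<and>
    (\<exists>i < ?n. \<exists>j < ?n. x $ i \<noteq> x $ j)}"
  assume fin: "finite ?S"
  obtain v i0 j0 where v: "vec ?n (\<lambda>i. real (v i)) \<in> nullspace M"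
    and ij: "i0 < ?n" "j0 < ?n" "v i0 \<noteq> v j0"
    using null_diagonal_nat_solution[OF M] .
  \<comment> \<open>Long enough that \<open>l + v i < k\<close> for every shift
    \<open>l \<le> card ?S\<close> and every entry of \<open>v\<close>.\<close>
  define k where "k = card ?S + (\<Sum>i<?n. v i) + 1"
  obtain a d where "d \<ge> 1" and ad: "AP k a d \<subseteq> A"
    using A unfolding AP_set_def k_def by (meson le_add2)
  define x where "x l = vec ?n (\<lambda>i. real (a + (l + v i) * d))" for l
  have "x l \<in> ?S" if l: "l \<le> card ?S" for l
  proof -
    \<comment> \<open>\<open>x l\<close> is \<open>a + l * d\<close> times the all-ones vector plus
      \<open>d\<close> times \<open>v\<close>, two elements of the nullspace.\<close>
    have "(\<Sum>i<?n. real_of_int (M $$ (r, i)) * real (a + (l + v i) * d)) =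
        real (a + l * d) * (\<Sum>i<?n. real_of_int (M $$ (r, i)) * 1) +
        real d * (\<Sum>i<?n. real_of_int (M $$ (r, i)) * real (v i))" for r
      by (simp add: sum_distrib_left sum.distrib algebra_simps)
    then have "x l \<in> nullspace M"
      using M v by (simp add: x_def null_diagonal_def vec_in_nullspace_iff)
    moreover have "a + (l + v i) * d \<in> A" if "i < ?n" for i
    proof -
      have "v i \<le> (\<Sum>i<?n. v i)"
        using that by (intro member_le_sum) auto
      then have "l + v i < k"
        using l by (simp add: k_def)
      then show ?thesis
        using ad by (auto simp: AP_def)
    qed
    then have "\<forall>i < ?n. x l $ i \<in> real ` A"
      by (simp add: x_def del: of_nat_add of_nat_mult)
    moreover have "x l $ i0 \<noteq> x l $ j0"
      using ij \<open>d \<ge> 1\<close> by (simp add: x_def)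
    ultimately show ?thesis
      using ij by blast
  qed
  then have "x ` {..card ?S} \<subseteq> ?S"
    by auto
  moreover have "inj_on x {..card ?S}"
  proof (rule inj_onI)
    fix l l' assume "x l = x l'"
    then have "x l $ i0 = x l' $ i0"
      by simp
    then show "l = l'"
      using ij \<open>d \<ge> 1\<close> by (simp add: x_def)
  qed
  ultimately have "card {..card ?S} \<le> card ?S"
    using fin by (intro card_inj_on_le)
  then show False
    by simp
qed

section \<open>Second differences; zero-solution sets are AP-sets\<close>

definition second_difference_mat :: "nat \<Rightarrow> int mat" where
  "second_difference_mat k =
     mat (k - 2) k (\<lambda>(r, i). if i = r + 1 then - 2 else if i = r \<or> i = r + 2 then 1 else 0)"

lemma dim_second_difference_mat [simp]:
  "dim_row (second_difference_mat k) = k - 2" "dim_col (second_difference_mat k) = k"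
  by (simp_all add: second_difference_mat_def)

lemma sum_second_difference_mat:
  assumes "r < k - 2"
  shows "(\<Sum>i<k. real_of_int (second_difference_mat k $$ (r, i)) * f i) =
    f r - 2 * f (r + 1) + f (r + 2)"
proof -
  have "(\<Sum>i<k. real_of_int (second_difference_mat k $$ (r, i)) * f i) =
      (\<Sum>i\<in>{r, r + 1, r + 2}. real_of_int (second_difference_mat k $$ (r, i)) * f i)"
    using assms by (intro sum.mono_neutral_right) (auto simp: second_difference_mat_def)
  also have "\<dots> = f r - 2 * f (r + 1) + f (r + 2)"
    using assms by (simp add: second_difference_mat_def)
  finally show ?thesis .
qed

text \<open>A vanishing second difference determines each entry from the two before it, hence strong
  induction. For \<open>k = 1\<close> the index 1 is out of range, but \<open>x $ 1\<close> is then
  multiplied by 0.\<close>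

lemma nullspace_second_difference_mat:
  assumes x: "x \<in> nullspace (second_difference_mat k)" and "i < k"
  shows "x $ i = x $ 0 + real i * (x $ 1 - x $ 0)"
  using \<open>i < k\<close>
proof (induction i rule: less_induct)
  case (less i)
  consider "i = 0" | "i = 1" | "i \<ge> 2"
    by linarith
  then show ?case
  proof cases
    case 3
    then obtain r where r: "i = r + 2"
      by (metis add.commute le_Suc_ex)
    then have "x $ r - 2 * x $ (r + 1) + x $ (r + 2) = 0"
      using x less.prems sum_second_difference_mat[of r k "\<lambda>i. x $ i"]
      by (simp add: nullspace_iff)
    then show ?thesis
      using less.IH[of r] less.IH[of "r + 1"] less.prems r by (simp add: algebra_simps)
  qed auto
qed

text \<open>With \<open>k\<close> columns and only \<open>k - 2\<close> rows the kernel has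
  dimension at least 2, and each row sums to 1 - 2 + 1 = 0.\<close>

lemma null_diagonal_second_difference_mat:
  assumes "k \<ge> 2"
  shows "null_diagonal (second_difference_mat k)"
proof -
  have "2 \<le> kernel_dim (map_mat real_of_int (second_difference_mat k))"
    using kernel_dim_ge_diff[of "map_mat real_of_int (second_difference_mat k)"] assms by simp
  moreover have "vec k (\<lambda>_. 1) \<in> nullspace (second_difference_mat k)"
    using vec_in_nullspace_iff[of "second_difference_mat k" "\<lambda>_. 1"]
      sum_second_difference_mat[of _ k "\<lambda>_. 1"] by simp
  ultimately show ?thesis
    by (simp add: null_diagonal_def)
qed

text \<open>Exchanging \<open>l\<close> and \<open>m - l\<close> reads the progression from its top
  element downwards, as decreasing solutions require. The equation is phrased additively to avoid
  truncated subtraction.\<close>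

lemma AP_Suc_reverse: "AP (Suc m) a d = {b. \<exists>l\<le>m. b + l * d = a + m * d}"
proof -
  have "(\<exists>l<Suc m. b = a + l * d) \<longleftrightarrow> (\<exists>l\<le>m. b + l * d = a + m * d)" for b
  proof
    assume "\<exists>l<Suc m. b = a + l * d"
    then obtain l where "l \<le> m" "b = a + l * d"
      by (auto simp only: less_Suc_eq_le)
    then have "b + (m - l) * d = a + m * d"
      by (simp flip: add_mult_distrib)
    then show "\<exists>l\<le>m. b + l * d = a + m * d"
      by (intro exI[of _ "m - l"]) simp
  next
    assume "\<exists>l\<le>m. b + l * d = a + m * d"
    then obtain l where "l \<le> m" "b + l * d = a + m * d"
      by auto
    moreover from this have "m * d = (m - l) * d + l * d"
      by (simp flip: add_mult_distrib)
    ultimately have "b = a + (m - l) * d"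
      by linarith
    then show "\<exists>l<Suc m. b = a + l * d"
      by (intro exI[of _ "m - l"]) simp
  qed
  then show ?thesis
    by (auto simp: AP_def)
qed

lemma AP_mono: "k \<le> k' \<Longrightarrow> AP k a d \<subseteq> AP k' a d"
  by (fastforce simp: AP_def)

lemma zero_solution_set_imp_AP:
  assumes A: "A \<subseteq> {1..}" and zero: "zero_solution_set A"
  shows "\<exists>a\<ge>1. \<exists>d\<ge>1. AP (m + 2) a d \<subseteq> A"
proof -
  let ?M = "second_difference_mat (m + 2)"
  let ?S = "{x \<in> nullspace ?M. (\<forall>i < m + 2. x $ i \<in> real ` A) \<and>
    (\<exists>i < m + 2. \<exists>j < m + 2. x $ i \<noteq> x $ j)}"
  have "infinite ?S"
    using zero[unfolded zero_solution_set_def, rule_format,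
        OF null_diagonal_second_difference_mat[of "m + 2"]] by simp
  then have "?S \<noteq> {}"
    using infinite_imp_nonempty by blast
  then obtain x where "x \<in> ?S"
    by blast
  then have x: "x \<in> nullspace ?M" and "\<forall>i < m + 2. \<exists>b\<in>A. x $ i = real b"
    and nonconst: "\<exists>i < m + 2. \<exists>j < m + 2. x $ i \<noteq> x $ j"
    by auto
  then obtain b where b: "\<And>i. i < m + 2 \<Longrightarrow> b i \<in> A" "\<And>i. i < m + 2 \<Longrightarrow> x $ i = real (b i)"
    by metis
  have lin: "real (b i) = real (b 0) + real i * (real (b 1) - real (b 0))" if "i < m + 2" for i
    using nullspace_second_difference_mat[OF x that] b(2)[of 0] b(2)[of 1] b(2)[OF that] by simp
  \<comment> \<open>Equal first entries would make the common difference 0 and the whole vector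
    constant by \<open>lin\<close>.\<close>
  from nonconst have "b 0 \<noteq> b 1"
    using lin b(2) by (metis add.right_neutral diff_self mult_zero_right)
  then consider "b 0 < b 1" | "b 1 < b 0"
    by linarith
  then show ?thesis
  proof cases
    case 1
    have "b 0 + l * (b 1 - b 0) = b l" if "l < m + 2" for l
    proof -
      have "real (b 0 + l * (b 1 - b 0)) = real (b l)"
        using 1 lin[OF that] by simp
      then show ?thesis
        by (simp only: of_nat_eq_iff)
    qed
    then have "AP (m + 2) (b 0) (b 1 - b 0) \<subseteq> A"
      using b(1) by (auto simp: AP_def)
    then show ?thesis
      using 1 A b(1)[of 0] by (intro exI[of _ "b 0"] exI[of _ "b 1 - b 0"] conjI) auto
  next
    case 2
    \<comment> \<open>The entries decrease, so the progression has the last entry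
      \<open>b (m + 1)\<close> as base and \<open>b 0\<close> as top.\<close>
    define d where "d = b 0 - b 1"
    have desc: "b l + l * d = b 0" if "l < m + 2" for l
    proof -
      have "real (b l + l * d) = real (b 0)"
      proof -
        have "real d = real (b 0) - real (b 1)"
          using 2 by (simp add: d_def)
        then show ?thesis
          using lin[OF that] by (simp add: right_diff_distrib)
      qed
      then show ?thesis
        by (simp only: of_nat_eq_iff)
    qed
    have "AP (Suc (m + 1)) (b (m + 1)) d \<subseteq> A"
      unfolding AP_Suc_reverse
    proof
      fix c assume "c \<in> {c. \<exists>l\<le>m + 1. c + l * d = b (m + 1) + (m + 1) * d}"
      then obtain l where "l \<le> m + 1" "c + l * d = b 0"
        using desc[of "m + 1"] by auto
      moreover from this have "b l + l * d = b 0"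
        by (intro desc) simp
      ultimately have "c = b l"
        by linarith
      then show "c \<in> A"
        using b(1)[of l] \<open>l \<le> m + 1\<close> by simp
    qed
    then show ?thesis
      using 2 A b(1)[of "m + 1"]
      by (intro exI[of _ "b (m + 1)"] exI[of _ d] conjI) (auto simp: d_def)
  qed
qed

theorem theorem16:
  fixes A :: "nat set"
  assumes "A \<subseteq> {1..}"
  shows "zero_solution_set A \<longleftrightarrow> AP_set A"
proof
  assume "zero_solution_set A"
  \<comment> \<open>For a required length \<open>k\<close>, a progression of length
    \<open>k + 2\<close> is found and cut down.\<close>
  then show "AP_set A"
    unfolding AP_set_def
    using zero_solution_set_imp_AP[OF assms] AP_mono[OF le_add1] by (meson subset_trans)
qed (rule AP_set_imp_zero_solution_set)

end
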